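(* For every natural number $n\geq 2$, \[ \varphi^2(n)\big(\psi(n)+\sigma(n)\big)+\psi^2(n)\big(\varphi(n)+\sigma(n)\big)+\sigma^2(n)\big(\varphi(n)+\psi(n)\big)\geq 6n^3+6n^2+2n+2. \]
   Context: For a natural number $n$, $\varphi(n)$ is Euler's totient function (the number of positive integers not exceeding $n$ that are coprime to $n$). For $n=p_1^{a_1}\cdots p_k^{a_k}$ (distinct primes $p_i$, $a_i\geq1$), the Dedekind function is $\psi(n)=\prod_{i=1}^k p_i^{a_i-1}(p_i+1)$, with $\psi(1)=1$. $\sigma(n)$ denotes the sum of the positive divisors of $n$. *)

theory Defs
  imports "HOL-Number_Theory.Totient"
begin

definition dedekind_psi :: "nat \<Rightarrow> nat" where
  "dedekind_psi n = (\<Prod>p\<in>prime_factors n. p ^ (multiplicity p n - 1) * (p + 1))"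

definition divisor_sum :: "nat \<Rightarrow> nat" where
  "divisor_sum n = (\<Sum>d | d dvd n. d)"

end

theory Submission
  imports Defs
begin

text \<open>
  Write \<open>x\<close>, \<open>y\<close>, \<open>z\<close> for the values of \<open>totient\<close>, \<open>dedekind_psi\<close>, \<open>divisor_sum\<close> at \<open>n\<close>.
  Since \<open>y \<le> z\<close>, the left-hand side is at least \<open>2y(x\<^sup>2 + xy + y\<^sup>2)\<close>, and
  \<open>4(x\<^sup>2 + xy + y\<^sup>2) = 3(x + y)\<^sup>2 + (y - x)\<^sup>2\<close>. The bounds \<open>x + y \<ge> 2n\<close>, \<open>x \<le> n - 1\<close> and
  \<open>y \<ge> n + 1\<close>, which are equalities when \<open>n\<close> is prime, then give \<open>2(n + 1)(3n\<^sup>2 + 1)\<close>.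
\<close>

text \<open>This form parallels \<open>totient_formula2\<close>, so that both functions can be
  compared through products over the same primes.\<close>

lemma dedekind_psi_formula:
  assumes "n > 0"
  shows "real (dedekind_psi n) = real n * (\<Prod>p\<in>prime_factors n. 1 + 1 / real p)"
proof -
  have "real (dedekind_psi n)
      = (\<Prod>p\<in>prime_factors n. real (p ^ multiplicity p n) * (1 + 1 / real p))"
    unfolding dedekind_psi_def of_nat_prod
  proof (rule prod.cong)
    fix p assume p: "p \<in> prime_factors n"
    \<comment> \<open>Positive multiplicity keeps the exponent \<open>multiplicity p n - 1\<close>
      from being truncated at 0.\<close>
    then have "p > 0" and "multiplicity p n > 0"
      by (auto simp: prime_factors_multiplicity prime_gt_0_nat)
    then show "real (p ^ (multiplicity p n - 1) * (p + 1))
        = real (p ^ multiplicity p n) * (1 + 1 / real p)"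
      by (cases "multiplicity p n") (auto simp: field_simps)
  qed simp
  also have "\<dots> = real (\<Prod>p\<in>prime_factors n. p ^ multiplicity p n)
      * (\<Prod>p\<in>prime_factors n. 1 + 1 / real p)"
    by (simp add: prod.distrib)
  also have "(\<Prod>p\<in>prime_factors n. p ^ multiplicity p n) = n"
    using prime_factorization_nat[OF assms] by simp
  finally show ?thesis .
qed

text \<open>Inserting \<open>b\<close> changes the sum by \<open>f b\<close> times the difference of
  the two products over \<open>A\<close>, which is nonnegative by comparing factors.\<close>

lemma prod_one_plus_add_prod_one_minus_ge_2:
  fixes f :: "'a \<Rightarrow> real"
  assumes "finite A" and "\<And>a. a \<in> A \<Longrightarrow> 0 \<le> f a \<and> f a \<le> 1"
  shows "(\<Prod>a\<in>A. 1 + f a) + (\<Prod>a\<in>A. 1 - f a) \<ge> 2"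
  using assms
proof (induction A rule: finite_induct)
  case (insert b A)
  have "(\<Prod>a\<in>A. 1 - f a) \<le> (\<Prod>a\<in>A. 1 + f a)"
    using insert.prems by (intro prod_mono) fastforce
  then have "0 \<le> f b * ((\<Prod>a\<in>A. 1 + f a) - (\<Prod>a\<in>A. 1 - f a))"
    using insert.prems by simp
  moreover have "2 \<le> (\<Prod>a\<in>A. 1 + f a) + (\<Prod>a\<in>A. 1 - f a)"
    using insert.prems by (intro insert.IH) auto
  ultimately show ?case
    using insert.hyps by (simp add: algebra_simps)
qed simp

lemma totient_add_dedekind_psi_ge:
  "2 * n \<le> totient n + dedekind_psi n"
proof (cases "n = 0")
  case False
  let ?f = "\<lambda>p::nat. 1 / real p"
  have "2 \<le> (\<Prod>p\<in>prime_factors n. 1 + ?f p) + (\<Prod>p\<in>prime_factors n. 1 - ?f p)"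
    by (rule prod_one_plus_add_prod_one_minus_ge_2)
      (auto dest!: in_prime_factors_imp_prime prime_ge_1_nat)
  then have "real n * 2 \<le> real n *
      ((\<Prod>p\<in>prime_factors n. 1 + ?f p) + (\<Prod>p\<in>prime_factors n. 1 - ?f p))"
    by (rule mult_left_mono) simp
  also have "\<dots> = real (totient n + dedekind_psi n)"
    using False by (simp add: dedekind_psi_formula totient_formula2 distrib_left)
  finally show ?thesis by linarith
qed simp

lemma dedekind_psi_gt:
  assumes "n \<ge> 2"
  shows "n < dedekind_psi n"
proof -
  have "(1::real) < (\<Prod>p\<in>prime_factors n. 1 + 1 / real p)"
  proof (rule less_1_prod)
    show "prime_factors n \<noteq> {}"
      using assms by (auto simp: prime_factorization_empty_iff)
  qed (auto dest!: in_prime_factors_imp_prime prime_gt_0_nat)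
  then show ?thesis
    using assms dedekind_psi_formula[of n]
    by (metis less_le_trans of_nat_less_iff of_nat_0_less_iff pos2
        mult_less_cancel_left_pos mult.right_neutral)
qed

text \<open>A set of primes can be recovered from its product; this makes distinct squarefree
  divisors correspond to distinct sets.\<close>

lemma prime_factors_prod_primes:
  fixes A :: "nat set"
  assumes "finite A" and "\<And>p. p \<in> A \<Longrightarrow> prime p"
  shows "prime_factors (\<Prod>A) = A"
proof -
  have "0 \<notin> A" using assms(2) by force
  then have "prime_factors (\<Prod>A) = (\<Union>p\<in>A. prime_factors p)"
    using assms by (subst prime_factors_prod) auto
  also have "\<dots> = A"
    using assms by (simp add: prime_factorization_prime)
  finally show ?thesis .
qed

text \<open>The product divides the radical of \<open>n\<close>, which divides
  \<open>n\<close>.\<close>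

lemma prod_dvd_of_subset_prime_factors:
  fixes n :: nat
  assumes "A \<subseteq> prime_factors n"
  shows "\<Prod>A dvd n"
proof (cases "n = 0")
  case False
  have "\<Prod>A dvd \<Prod>(prime_factors n)"
    using assms by (intro prod_dvd_prod_subset) auto
  also have "\<dots> dvd (\<Prod>p\<in>prime_factors n. p ^ multiplicity p n)"
    by (intro prod_dvd_prod dvd_power) (auto simp: prime_factors_multiplicity)
  also have "\<dots> = n"
    using prime_factorization_nat[of n] False by simp
  finally show ?thesis .
qed simp

text \<open>
  Expanding the product \<open>\<Prod>(1 + 1/p)\<close> exhibits \<open>dedekind_psi n\<close> as the sum of the divisors
  \<open>n / d\<close> with \<open>d\<close> squarefree.
\<close>

lemma dedekind_psi_le_divisor_sum:
  assumes "n > 0"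
  shows "dedekind_psi n \<le> divisor_sum n"
proof -
  let ?P = "prime_factors n"
  have dvd: "\<Prod>A dvd n" if "A \<in> Pow ?P" for A
    using that prod_dvd_of_subset_prime_factors by blast
  \<comment> \<open>Injectivity turns the sum over sets of primes into a sum over distinct divisors,
    without repetition.\<close>
  have inj: "inj_on (\<lambda>A. n div \<Prod>A) (Pow ?P)"
  proof (rule inj_onI)
    fix A B assume A: "A \<in> Pow ?P" and B: "B \<in> Pow ?P" and eq: "n div \<Prod>A = n div \<Prod>B"
    have "\<Prod>A = \<Prod>B"
      using dvd[OF A] dvd[OF B] eq assms
      by (metis dvd_div_eq_cancel dvd_div_mult_self mult_eq_0_iff mult_left_cancel not_less_zero)
    moreover have "prime_factors (\<Prod>C) = C" if "C \<in> Pow ?P" for C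
      using that by (intro prime_factors_prod_primes) (auto intro: finite_subset)
    ultimately show "A = B" using A B by metis
  qed
  \<comment> \<open>Here \<open>A\<close> is the set of primes whose factor contributes
    \<open>1 / p\<close>; the others contribute 1.\<close>
  have "real (dedekind_psi n) = real n * (\<Sum>A\<in>Pow ?P. \<Prod>p\<in>A. 1 / real p)"
    using assms by (simp add: dedekind_psi_formula add.commute[of 1] prod_add)
  also have "\<dots> = (\<Sum>A\<in>Pow ?P. real (n div \<Prod>A))"
    unfolding sum_distrib_left using dvd
    by (intro sum.cong) (simp_all add: real_of_nat_div prod_dividef)
  finally have "dedekind_psi n = (\<Sum>A\<in>Pow ?P. n div \<Prod>A)"
    by (metis of_nat_eq_iff of_nat_sum)
  also have "\<dots> = \<Sum>((\<lambda>A. n div \<Prod>A) ` Pow ?P)"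
    using inj by (simp add: sum.reindex)
  also have "\<dots> \<le> \<Sum>{d. d dvd n}"
  proof (rule sum_mono2)
    show "(\<lambda>A. n div \<Prod>A) ` Pow ?P \<subseteq> {d. d dvd n}"
    proof
      fix d assume "d \<in> (\<lambda>A. n div \<Prod>A) ` Pow ?P"
      then obtain A where "A \<in> Pow ?P" and d: "d = n div \<Prod>A" by blast
      then have "d * \<Prod>A = n" using dvd by simp
      then show "d \<in> {d. d dvd n}" by auto
    qed
  qed (use assms in auto)
  finally show ?thesis by (simp add: divisor_sum_def)
qed

theorem theorem4:
  fixes n :: nat
  assumes "n \<ge> 2"
  shows "(totient n)\<^sup>2 * (dedekind_psi n + divisor_sum n)
       + (dedekind_psi n)\<^sup>2 * (totient n + divisor_sum n)
       + (divisor_sum n)\<^sup>2 * (totient n + dedekind_psi n)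
       \<ge> 6 * n ^ 3 + 6 * n\<^sup>2 + 2 * n + 2"
proof -
  \<comment> \<open>Passing to integers makes the subtraction in \<open>y - x\<close> and
    \<open>m - 1\<close> genuine.\<close>
  define x y z where "x = int (totient n)" and "y = int (dedekind_psi n)" and "z = int (divisor_sum n)"
  define m where "m = int n"
  have xy: "x + y \<ge> 2 * m"
    using totient_add_dedekind_psi_ge[of n] by (simp add: x_def y_def m_def)
  have x: "0 \<le> x" "x \<le> m - 1"
    using totient_less[of n] assms by (simp_all add: x_def m_def)
  have y: "y \<ge> m + 1"
    using dedekind_psi_gt[OF assms] by (simp add: y_def m_def)
  have z: "y \<le> z"
    using dedekind_psi_le_divisor_sum[of n] assms by (simp add: y_def z_def)
  have m: "0 \<le> m" by (simp add: m_def)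
  \<comment> \<open>The second square uses \<open>y - x \<ge> (m + 1) - (m - 1) = 2\<close>;
    dividing by 4 gives the next claim.\<close>
  have "3 * (2 * m)\<^sup>2 + 2\<^sup>2 \<le> 3 * (x + y)\<^sup>2 + (y - x)\<^sup>2"
    using xy x y m by (intro add_mono mult_left_mono power_mono) auto
  then have q: "3 * m\<^sup>2 + 1 \<le> x\<^sup>2 + x * y + y\<^sup>2"
    by (simp add: power2_eq_square algebra_simps)
  have "6 * m ^ 3 + 6 * m\<^sup>2 + 2 * m + 2 = 2 * (m + 1) * (3 * m\<^sup>2 + 1)"
    by (simp add: power2_eq_square power3_eq_cube algebra_simps)
  also have "\<dots> \<le> 2 * y * (x\<^sup>2 + x * y + y\<^sup>2)"
    using q y m by (intro mult_mono) auto
  \<comment> \<open>Arranged like the goal with \<open>z\<close> replaced by \<open>y\<close>, so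
    that \<open>y \<le> z\<close> applies term by term.\<close>
  also have "\<dots> = x\<^sup>2 * (y + y) + y\<^sup>2 * (x + y) + y\<^sup>2 * (x + y)"
    by (simp add: power2_eq_square algebra_simps)
  also have "\<dots> \<le> x\<^sup>2 * (y + z) + y\<^sup>2 * (x + z) + z\<^sup>2 * (x + y)"
    using x y z m by (intro add_mono mult_left_mono mult_right_mono power_mono) auto
  finally have "int (6 * n ^ 3 + 6 * n\<^sup>2 + 2 * n + 2)
      \<le> int ((totient n)\<^sup>2 * (dedekind_psi n + divisor_sum n)
       + (dedekind_psi n)\<^sup>2 * (totient n + divisor_sum n)
       + (divisor_sum n)\<^sup>2 * (totient n + dedekind_psi n))"
    by (simp add: x_def y_def z_def m_def)
  then show ?thesis by (simp only: of_nat_le_iff)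
qed

end
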